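(* Let $P$ be a matrix with supporting graph $\mathcal G=(V,\mathcal E)$. Let $\mathcal S$ be a family of subsets of $V$ such that the cocycle vectors $u(B)$, $B\in\mathcal S$, span the cocycle space. (1) $P$ is a reversible Markov matrix if, and only if, there exists a non-negative symmetric function $s$ on $V\times V$ which is supported on the edges $\mathcal E$ and there exist positive parameters $t_B>0$, $B\in\mathcal S$, such that $$P_{v\to w}=s(v,w)\prod_{B\in\mathcal S\colon v\in B,\,w\notin B}t_B\ \prod_{B\in\mathcal S\colon w\in B,\,v\notin B}t_B^{-1},\qquad (v\to w)\in\mathcal A,$$ and the invariant probability is proportional to $\kappa(v)=\prod_{B\in\mathcal S\colon v\in B}t_B^{-2}$, $v\in V$. (2) For $v\in V$, $$\prod_{B\in\mathcal S\colon v\in B}t_B^{-1}\ \ge\ \sum_{w\in N(v)}s(v,w)\prod_{B\in\mathcal S\colon w\in B}t_B^{-1}.$$ (3) The parameters $s(e)$, $e\in\mathcal E$, and $\kappa(v)$, $v\in V$, are identifiable, while the parameters $t_B$, $B\in\mathcal S$, are identifiable if $u(B)$, $B\in\mathcal S$, is a basis of the cocycle space.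
   Context: $\mathcal G=(V,\mathcal E)$ is a finite connected undirected graph; $\overline{vw}$ denotes the edge joining $v\neq w$, and $N(v)$ is the set of vertices adjacent to $v$. Splitting each edge $\overline{vw}$ into the two arcs $v\to w$ and $w\to v$ gives the directed graph $\mathcal D=(V,\mathcal A)$, without loops. The matrix $P=[P_{v\to w}]_{v,w\in V}$ has supporting graph $\mathcal G$ if, for $v\neq w$, $\overline{vw}$ is an edge if, and only if, $P_{v\to w}$ and $P_{w\to v}$ are both positive, the entries $P_{v\to w}$ with $v\ne w$, $\overline{vw}\notin\mathcal E$, being zero. A Markov matrix on $V$ (non-negative entries, row sums equal to 1) with such a structure is described by its values on the arcs, the diagonal being $P_{v\to v}=1-\sum_{w\in N(v)}P_{v\to w}$. A Markov matrix is reversible if there exist $\kappa(v)>0$, $v\in V$, with $\kappa(v)P_{v\to w}=\kappa(w)P_{w\to v}$ for all $v,w\in V$ (detailed balance); then $\kappa$, normalized to sum 1, is an invariant probability. For $\emptyset\neq B\subsetneq V$ the cocycle vector $u(B)=(u_a(B)\colon a\in\mathcal A)$ is given by $u_a(B)=+1$ if the arc $a$ exits from $B$, $-1$ if $a$ enters into $B$, and $0$ otherwise. The cocycle space is the subspace of $\mathbb R^{\mathcal A}$ generated by all cocycle vectors. The members of $\mathcal S$ are non-empty proper subsets of $V$. For an edge $e=\overline{vw}$, $s(e)$ denotes $s(v,w)=s(w,v)$. A parameter is identifiable if it is uniquely determined by $P$.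
   Formalization: In (1) the "if" direction assumes P has non-negative diagonal, or alternatively includes inequality (2) among the conditions; in (3) κ is identifiable after normalization to sum 1, and without normalization when the u(B) form a basis. *)

theory Defs
  imports "HOL-Analysis.Analysis"
begin

text \<open>The vertex set is a finite type, so that matrices and vectors are those of
  \<open>HOL-Analysis\<close>; an edge is the two-element set of its endpoints.\<close>

definition arcs :: "'v set set \<Rightarrow> ('v \<times> 'v) set" where
  "arcs E = {(v, w). v \<noteq> w \<and> {v, w} \<in> E}"

definition nbrs :: "'v set set \<Rightarrow> 'v \<Rightarrow> 'v set" where
  "nbrs E v = {w. (v, w) \<in> arcs E}"

definition connected_graph :: "'v set set \<Rightarrow> bool" where
  "connected_graph E \<longleftrightarrow> (\<forall>e\<in>E. card e = 2) \<and> (\<forall>v w. (v, w) \<in> (arcs E)\<^sup>*)"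

text \<open>The diagonal is not constrained here.\<close>

definition supporting_graph :: "'v set set \<Rightarrow> real^'v^'v \<Rightarrow> bool" where
  "supporting_graph E P \<longleftrightarrow>
     (\<forall>v w. v \<noteq> w \<longrightarrow>
        ({v, w} \<in> E \<longleftrightarrow> P $ v $ w > 0 \<and> P $ w $ v > 0) \<and>
        ({v, w} \<notin> E \<longrightarrow> P $ v $ w = 0))"

definition markov_matrix :: "real^('v::finite)^'v \<Rightarrow> bool" where
  "markov_matrix P \<longleftrightarrow> (\<forall>v w. 0 \<le> P $ v $ w) \<and> (\<forall>v. (\<Sum>w\<in>UNIV. P $ v $ w) = 1)"

definition reversible :: "real^'v^'v \<Rightarrow> bool" where
  "reversible P \<longleftrightarrow>
     (\<exists>k. (\<forall>v. 0 < k v) \<and> (\<forall>v w. k v * P $ v $ w = k w * P $ w $ v))"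

definition invariant_probability :: "real^('v::finite)^'v \<Rightarrow> real^'v \<Rightarrow> bool" where
  "invariant_probability P p \<longleftrightarrow>
     (\<forall>v. 0 \<le> p $ v) \<and> (\<Sum>v\<in>UNIV. p $ v) = 1 \<and> p v* P = p"

text \<open>Vectors indexed by the arcs are encoded as vectors indexed by all ordered pairs of
  vertices that vanish outside the arcs; linear span and linear independence are unaffected.\<close>

definition cocycle_vector :: "'v set set \<Rightarrow> 'v set \<Rightarrow> real^('v::finite \<times> 'v)" where
  "cocycle_vector E B =
     (\<chi> a. if a \<notin> arcs E then 0
           else if fst a \<in> B \<and> snd a \<notin> B then 1
           else if fst a \<notin> B \<and> snd a \<in> B then - 1
           else 0)"

definition cocycle_space :: "'v set set \<Rightarrow> (real^('v::finite \<times> 'v)) set" where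
  "cocycle_space E = span (cocycle_vector E ` {B. B \<noteq> {} \<and> B \<noteq> UNIV})"

text \<open>Injectivity makes this a condition on the indexed family, not only on its range.\<close>

definition cocycle_basis :: "'v set set \<Rightarrow> ('v::finite) set set \<Rightarrow> bool" where
  "cocycle_basis E S \<longleftrightarrow>
     inj_on (cocycle_vector E) S \<and> independent (cocycle_vector E ` S) \<and>
     span (cocycle_vector E ` S) = cocycle_space E"

text \<open>Only the values of \<open>t\<close> on \<open>S\<close> are relevant.\<close>

definition parametrization ::
    "'v set set \<Rightarrow> 'v set set \<Rightarrow> real^'v^'v \<Rightarrow> ('v \<Rightarrow> 'v \<Rightarrow> real) \<Rightarrow> ('v set \<Rightarrow> real) \<Rightarrow> bool" where
  "parametrization E S P s t \<longleftrightarrow>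
     (\<forall>v w. 0 \<le> s v w) \<and> (\<forall>v w. s v w = s w v) \<and>
     (\<forall>v w. {v, w} \<notin> E \<longrightarrow> s v w = 0) \<and>
     (\<forall>B\<in>S. 0 < t B) \<and>
     (\<forall>(v, w)\<in>arcs E.
        P $ v $ w = s v w * (\<Prod>B\<in>{B\<in>S. v \<in> B \<and> w \<notin> B}. t B)
                          * (\<Prod>B\<in>{B\<in>S. w \<in> B \<and> v \<notin> B}. inverse (t B)))"

definition kappa :: "'v set set \<Rightarrow> ('v set \<Rightarrow> real) \<Rightarrow> 'v \<Rightarrow> real" where
  "kappa S t v = (\<Prod>B\<in>{B\<in>S. v \<in> B}. inverse ((t B)\<^sup>2))"

definition normalized :: "('v::finite \<Rightarrow> real) \<Rightarrow> real^'v" where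
  "normalized k = (\<chi> v. k v / (\<Sum>w\<in>UNIV. k w))"

text \<open>An invariant probability exists, is unique, and is proportional to \<open>k\<close>.\<close>

definition the_invariant_probability_proportional_to ::
    "real^('v::finite)^'v \<Rightarrow> ('v \<Rightarrow> real) \<Rightarrow> bool" where
  "the_invariant_probability_proportional_to P k \<longleftrightarrow>
     (\<forall>p. invariant_probability P p \<longleftrightarrow> p = normalized k)"

definition vertex_inequality ::
    "'v set set \<Rightarrow> 'v set set \<Rightarrow> ('v \<Rightarrow> 'v \<Rightarrow> real) \<Rightarrow> ('v set \<Rightarrow> real) \<Rightarrow> 'v \<Rightarrow> bool" where
  "vertex_inequality E S s t v \<longleftrightarrow>
     (\<Prod>B\<in>{B\<in>S. v \<in> B}. inverse (t B))
       \<ge> (\<Sum>w\<in>nbrs E v. s v w * (\<Prod>B\<in>{B\<in>S. w \<in> B}. inverse (t B)))"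

text \<open>\<open>q\<close> is a function of the parameters; it is identifiable if \<open>P\<close> determines its value.\<close>

definition identifiable ::
    "'v set set \<Rightarrow> 'v set set \<Rightarrow> real^'v^'v \<Rightarrow>
     (('v \<Rightarrow> 'v \<Rightarrow> real) \<Rightarrow> ('v set \<Rightarrow> real) \<Rightarrow> 'b) \<Rightarrow> bool" where
  "identifiable E S P q \<longleftrightarrow>
     (\<forall>s t s' t'. parametrization E S P s t \<longrightarrow> parametrization E S P s' t' \<longrightarrow> q s t = q s' t')"

end

theory Submission
  imports Defs
begin

text \<open>Let $g(v)$ be the product of the $t_B$ over the sets $B$ of the family that contain $v$. The
  factors with $v, w$ both in $B$ cancel, so the parametrization says
  $P_{v\to w} = s(v,w)\, g(v) / g(w)$, and $\kappa = g^{-2}$ satisfies detailed balance. Conversely,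
  if $P$ satisfies detailed balance with respect to $k$, the coboundary of $-\frac12 \ln k$ lies in
  the cocycle space; its coefficients on the $u(B)$ are the $\ln t_B$. Uniqueness of the invariant
  probability is the maximum principle for harmonic functions. Identifiability follows from
  $P_{v\to w} P_{w\to v} = s(v,w)^2$: hence $P$ determines the ratios $g(v)/g(w)$ along the arcs,
  that is, the vector $\sum_B \ln t_B\, u(B)$.\<close>

section \<open>Vertex weights and the parametrization\<close>

text \<open>A multiplicative potential on the vertices: the parameters \<open>t\<close> enter the
  entries on the arcs only through its ratios.\<close>

definition vertex_weight :: "'v set set \<Rightarrow> ('v set \<Rightarrow> real) \<Rightarrow> 'v \<Rightarrow> real" where
  "vertex_weight S t v = (\<Prod>B\<in>{B\<in>S. v \<in> B}. t B)"

lemma vertex_weight_pos: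
  assumes "\<forall>B\<in>S. 0 < t B"
  shows "0 < vertex_weight S t v"
  using assms unfolding vertex_weight_def by (intro prod_pos) auto

lemma prod_inverse_eq_vertex_weight:
  "(\<Prod>B\<in>{B\<in>S. v \<in> B}. inverse (t B)) = inverse (vertex_weight S t v)"
  unfolding vertex_weight_def by (rule prod_inversef[unfolded comp_def])

lemma kappa_eq_vertex_weight: "kappa S t v = inverse ((vertex_weight S t v)\<^sup>2)"
  unfolding kappa_def vertex_weight_def
  by (simp add: prod_inversef[unfolded comp_def] prod_power_distrib)

lemma kappa_pos:
  assumes "\<forall>B\<in>S. 0 < t B"
  shows "0 < kappa S t v"
  using vertex_weight_pos[OF assms, of v] by (simp add: kappa_eq_vertex_weight)

lemma vertex_weight_ratio:
  fixes S :: "'v::finite set set"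
  assumes "\<forall>B\<in>S. 0 < t B"
  shows "(\<Prod>B\<in>{B\<in>S. v \<in> B \<and> w \<notin> B}. t B) * (\<Prod>B\<in>{B\<in>S. w \<in> B \<and> v \<notin> B}. inverse (t B))
    = vertex_weight S t v / vertex_weight S t w"
proof -
  \<comment> \<open>The sets containing \<open>x\<close> are sorted by whether they also contain
    \<open>y\<close>; the second product is the factor common to both weights.\<close>
  have split: "vertex_weight S t x =
      (\<Prod>B\<in>{B\<in>S. x \<in> B \<and> y \<notin> B}. t B) * (\<Prod>B\<in>{B\<in>S. x \<in> B \<and> y \<in> B}. t B)" for x y
    unfolding vertex_weight_def
    by (subst prod.union_disjoint[symmetric]) (auto intro!: prod.cong)
  have sym: "{B\<in>S. w \<in> B \<and> v \<in> B} = {B\<in>S. v \<in> B \<and> w \<in> B}" by auto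
  have "0 < (\<Prod>B\<in>{B\<in>S. v \<in> B \<and> w \<in> B}. t B)" "0 < (\<Prod>B\<in>{B\<in>S. w \<in> B \<and> v \<notin> B}. t B)"
    using assms by (auto intro!: prod_pos)
  then show ?thesis
    unfolding split[of v w] split[of w v] sym prod_inversef[unfolded comp_def]
    by (simp add: divide_inverse del: prod_zero_iff prod_eq_1_iff)
qed

lemma parametrization_iff:
  fixes S :: "'v::finite set set"
  shows "parametrization E S P s t \<longleftrightarrow>
     (\<forall>v w. 0 \<le> s v w) \<and> (\<forall>v w. s v w = s w v) \<and>
     (\<forall>v w. {v, w} \<notin> E \<longrightarrow> s v w = 0) \<and> (\<forall>B\<in>S. 0 < t B) \<and>
     (\<forall>(v, w)\<in>arcs E. P $ v $ w = s v w * (vertex_weight S t v / vertex_weight S t w))"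
  unfolding parametrization_def
  by (auto simp: mult.assoc vertex_weight_ratio)

section \<open>Arcs, supporting graph and connectedness\<close>

lemma arcs_sym: "(v, w) \<in> arcs E \<Longrightarrow> (w, v) \<in> arcs E"
  by (auto simp: arcs_def insert_commute)

lemma supporting_graph_pos:
  assumes "supporting_graph E P" "(v, w) \<in> arcs E"
  shows "0 < P $ v $ w"
  using assms by (auto simp: supporting_graph_def arcs_def)

lemma supporting_graph_zero:
  assumes "supporting_graph E P" "v \<noteq> w" "(v, w) \<notin> arcs E"
  shows "P $ v $ w = 0"
  using assms unfolding supporting_graph_def arcs_def by blast

lemma supporting_graph_off_diagonal_nonneg:
  assumes "supporting_graph E P" "v \<noteq> w"
  shows "0 \<le> P $ v $ w"
  using supporting_graph_pos[OF assms(1), of v w] supporting_graph_zero[OF assms] by fastforce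

lemma connected_graph_const:
  assumes "connected_graph E" and "\<And>v w. (v, w) \<in> arcs E \<Longrightarrow> f v = f w"
  shows "f v = f w"
proof -
  have "(v, w) \<in> (arcs E)\<^sup>*" using assms(1) by (simp add: connected_graph_def)
  then show ?thesis by induction (simp_all add: assms(2))
qed

text \<open>Off the diagonal only neighbours contribute. The diagonal entry stands apart because
  \<open>supporting_graph\<close> leaves it free.\<close>

lemma supporting_graph_row_sum:
  fixes P :: "real^'v::finite^'v"
  assumes "supporting_graph E P"
  shows "(\<Sum>w\<in>UNIV. P $ v $ w) = P $ v $ v + (\<Sum>w\<in>nbrs E v. P $ v $ w)"
proof -
  have "(\<Sum>w\<in>UNIV. P $ v $ w) = P $ v $ v + (\<Sum>w\<in>UNIV - {v}. P $ v $ w)"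
    by (simp add: sum.remove)
  also have "(\<Sum>w\<in>UNIV - {v}. P $ v $ w) = (\<Sum>w\<in>nbrs E v. P $ v $ w)"
    by (rule sum.mono_neutral_right)
      (auto simp: nbrs_def intro!: supporting_graph_zero[OF assms], simp add: arcs_def)
  finally show ?thesis .
qed

section \<open>Detailed balance and the invariant probability\<close>

text \<open>On an arc both sides equal \<open>s v w\<close> divided by the product of the weights of
  \<open>v\<close> and \<open>w\<close>, which is symmetric. Elsewhere both entries vanish or
  \<open>v = w\<close>.\<close>

lemma parametrization_detailed_balance:
  fixes S :: "'v::finite set set"
  assumes "supporting_graph E P" and par: "parametrization E S P s t"
  shows "kappa S t v * P $ v $ w = kappa S t w * P $ w $ v"
proof (cases "(v, w) \<in> arcs E")
  case True
  have pos: "0 < vertex_weight S t x" for x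
    using par by (simp add: parametrization_iff vertex_weight_pos)
  have "P $ v $ w = s v w * (vertex_weight S t v / vertex_weight S t w)"
    "P $ w $ v = s w v * (vertex_weight S t w / vertex_weight S t v)" "s v w = s w v"
    using par True arcs_sym[OF True] unfolding parametrization_iff by auto
  then show ?thesis using pos[of v] pos[of w]
    by (simp add: kappa_eq_vertex_weight field_simps power2_eq_square)
next
  case False
  then show ?thesis
    using supporting_graph_zero[OF assms(1), of v w] supporting_graph_zero[OF assms(1), of w v]
      arcs_sym[of w v E] by (cases "v = w") auto
qed

text \<open>Where \<open>h\<close> attains its maximum it is an average of values not exceeding that
  maximum, so every neighbour, having positive weight, attains it as well. Connectedness carries
  this to all vertices.\<close>

lemma harmonic_const:
  fixes P :: "real^'v::finite^'v"
  assumes conn: "connected_graph E" and supp: "supporting_graph E P" and markov: "markov_matrix P"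
    and harm: "\<And>v. (\<Sum>w\<in>UNIV. P $ v $ w * h w) = h v"
  shows "h v = h w"
proof -
  define M where "M = Max (range h)"
  have le: "h x \<le> M" for x by (simp add: M_def)
  have "M \<in> range h" unfolding M_def by (rule Max_in) auto
  then obtain x0 where x0: "h x0 = M" by auto
  have step: "h y = M" if "(x, y) \<in> arcs E" "h x = M" for x y
  proof -
    \<comment> \<open>The weighted deficits from the maximum are non-negative and sum to zero, so
      each of them is zero.\<close>
    have "(\<Sum>w\<in>UNIV. P $ x $ w * (M - h w)) = (\<Sum>w\<in>UNIV. P $ x $ w) * M - h x"
      by (simp add: right_diff_distrib sum_subtractf harm sum_distrib_right)
    also have "\<dots> = 0" using markov that by (simp add: markov_matrix_def)
    finally have "\<forall>w\<in>UNIV. P $ x $ w * (M - h w) = 0"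
      using markov le by (subst (asm) sum_nonneg_eq_0_iff) (auto simp: markov_matrix_def)
    then have "P $ x $ y * (M - h y) = 0" by blast
    then show ?thesis using supporting_graph_pos[OF supp that(1)] by simp
  qed
  have "h x = M" for x
  proof -
    have "(x0, x) \<in> (arcs E)\<^sup>*" using conn by (simp add: connected_graph_def)
    then show ?thesis by induction (use x0 step in blast)+
  qed
  then show ?thesis by simp
qed

text \<open>Summing detailed balance over one vertex shows that \<open>k\<close> is invariant. For
  uniqueness, detailed balance turns invariance of \<open>p\<close> into harmonicity of the density
  of \<open>p\<close> with respect to \<open>k\<close>.\<close>

lemma invariant_probability_detailed_balance:
  fixes P :: "real^'v::finite^'v"
  assumes conn: "connected_graph E" and supp: "supporting_graph E P" and markov: "markov_matrix P"
    and pos: "\<And>v. 0 < k v" and bal: "\<And>v w. k v * P $ v $ w = k w * P $ w $ v"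
  shows "the_invariant_probability_proportional_to P k"
  unfolding the_invariant_probability_proportional_to_def
proof (intro allI iffI)
  define K where "K = (\<Sum>w\<in>UNIV. k w)"
  have K: "0 < K" unfolding K_def by (rule sum_pos) (auto simp: pos)
  show "invariant_probability P p" if p: "p = normalized k" for p
    unfolding invariant_probability_def
  proof (intro conjI allI)
    show "0 \<le> p $ v" for v
      using K less_imp_le[OF pos[of v]] by (simp add: p normalized_def K_def)
    show "(\<Sum>v\<in>UNIV. p $ v) = 1"
      using K by (simp add: p normalized_def K_def flip: sum_divide_distrib)
    show "p v* P = p"
    proof (rule vec_eq_iff[THEN iffD2, rule_format])
      fix v
      have "(p v* P) $ v = (\<Sum>w\<in>UNIV. k w * P $ w $ v) / K"
        by (simp add: vector_matrix_mult_def p normalized_def K_def sum_divide_distrib mult.commute)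
      also have "(\<Sum>w\<in>UNIV. k w * P $ w $ v) = k v * (\<Sum>w\<in>UNIV. P $ v $ w)"
        by (simp add: bal[of _ v] sum_distrib_left)
      also have "\<dots> = k v" using markov by (simp add: markov_matrix_def)
      finally show "(p v* P) $ v = p $ v" by (simp add: p normalized_def K_def)
    qed
  qed
  show "p = normalized k" if p: "invariant_probability P p" for p
  proof -
    define h where "h v = p $ v / k v" for v
    have ph: "p $ v = k v * h v" for v using pos[of v] by (simp add: h_def)
    have "(\<Sum>w\<in>UNIV. P $ v $ w * h w) = h v" for v
    proof -
      have "k v * (\<Sum>w\<in>UNIV. P $ v $ w * h w) = (\<Sum>w\<in>UNIV. (k v * P $ v $ w) * h w)"
        by (simp add: sum_distrib_left mult.assoc)
      also have "\<dots> = (\<Sum>w\<in>UNIV. P $ w $ v * p $ w)"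
        by (simp add: bal[of v] ph mult_ac)
      also have "\<dots> = (p v* P) $ v" by (simp add: vector_matrix_mult_def mult.commute)
      also have "\<dots> = k v * h v" using p by (simp add: invariant_probability_def ph)
      finally show ?thesis using pos[of v] by simp
    qed
    note const = harmonic_const[where h = h, OF conn supp markov this]
    obtain c where c: "\<And>v. h v = c" using const by blast
    \<comment> \<open>The density is a constant, and the total mass 1 fixes its value.\<close>
    have "1 = (\<Sum>v\<in>UNIV. p $ v)" using p by (simp add: invariant_probability_def)
    also have "\<dots> = K * c" by (simp add: ph c K_def sum_distrib_right)
    finally have "c = 1 / K" using K by (simp add: field_simps)
    then show ?thesis by (simp add: vec_eq_iff normalized_def ph c K_def)
  qed
qed

text \<open>Detailed balance rewrites the invariance equation at \<open>v\<close> as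
  \<open>k v\<close> equal to \<open>k v\<close> times the row sum. This recovers the unit row sums
  where \<open>P\<close> is not yet known to be a Markov matrix.\<close>

lemma row_sum_if_invariant_probability_proportional:
  fixes P :: "real^'v::finite^'v"
  assumes pos: "\<And>v. 0 < k v" and bal: "\<And>v w. k v * P $ v $ w = k w * P $ w $ v"
    and inv: "the_invariant_probability_proportional_to P k"
  shows "(\<Sum>w\<in>UNIV. P $ v $ w) = 1"
proof -
  define K where "K = (\<Sum>w\<in>UNIV. k w)"
  have K: "0 < K" unfolding K_def by (rule sum_pos) (auto simp: pos)
  have "invariant_probability P (normalized k)"
    using inv by (simp add: the_invariant_probability_proportional_to_def)
  then have "normalized k v* P = normalized k" by (simp add: invariant_probability_def)
  then have "k v / K = (normalized k v* P) $ v" by (simp add: normalized_def K_def)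
  also have "\<dots> = (\<Sum>w\<in>UNIV. k w * P $ w $ v) / K"
    by (simp add: vector_matrix_mult_def normalized_def K_def sum_divide_distrib mult.commute)
  also have "\<dots> = k v * (\<Sum>w\<in>UNIV. P $ v $ w) / K"
    by (simp add: bal[of _ v] sum_distrib_left)
  finally show ?thesis using K pos[of v] by (simp add: field_simps)
qed

section \<open>The vertex inequality\<close>

text \<open>Multiplying the inequality by the positive weight of \<open>v\<close> turns its terms
  into the entries of \<open>P\<close>. With unit row sums it therefore expresses non-negativity of
  the diagonal.\<close>

lemma vertex_inequality_iff:
  fixes S :: "'v::finite set set"
  assumes par: "parametrization E S P s t"
  shows "vertex_inequality E S s t v \<longleftrightarrow> (\<Sum>w\<in>nbrs E v. P $ v $ w) \<le> 1"
proof -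
  have pos: "0 < vertex_weight S t x" for x
    using par by (simp add: parametrization_iff vertex_weight_pos)
  have "(\<Sum>w\<in>nbrs E v. P $ v $ w)
      = (\<Sum>w\<in>nbrs E v. vertex_weight S t v * (s v w * inverse (vertex_weight S t w)))"
    using par by (intro sum.cong) (auto simp: parametrization_iff nbrs_def divide_inverse)
  also have "\<dots> = vertex_weight S t v * (\<Sum>w\<in>nbrs E v. s v w * inverse (vertex_weight S t w))"
    by (simp add: sum_distrib_left)
  finally show ?thesis using pos[of v]
    unfolding vertex_inequality_def prod_inverse_eq_vertex_weight by (simp add: field_simps)
qed

section \<open>Cocycle vectors and existence of the parametrization\<close>

text \<open>Coefficients in a span belong to vectors, while the parameters belong to sets, and
  distinct sets may have the same cocycle vector. One index is chosen for each vector; the other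
  indices receive the coefficient 0.\<close>

lemma span_image_finite:
  assumes "finite A" and "x \<in> span (f ` A)"
  obtains c where "x = (\<Sum>a\<in>A. c a *\<^sub>R f a)"
proof -
  obtain A' where A': "A' \<subseteq> A" "inj_on f A'" "f ` A = f ` A'"
    using subset_image_inj[of "f ` A" f A] by auto
  have "x \<in> range (\<lambda>r. \<Sum>y\<in>f ` A. r y *\<^sub>R y)"
    using assms by (simp add: span_finite)
  then obtain r where "x = (\<Sum>y\<in>f ` A'. r y *\<^sub>R y)"
    unfolding A'(3) by blast
  also have "\<dots> = (\<Sum>a\<in>A'. r (f a) *\<^sub>R f a)"
    by (simp add: sum.reindex A'(2))
  also have "\<dots> = (\<Sum>a\<in>A. (if a \<in> A' then r (f a) else 0) *\<^sub>R f a)"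
    using assms(1) A'(1) by (intro sum.mono_neutral_cong_left) auto
  finally show ?thesis by (rule that)
qed

text \<open>On an arc, \<open>cocycle_vector E B\<close> is the difference of the indicator of
  \<open>B\<close> at the two endpoints, so a linear combination is the coboundary of the combined
  indicators.\<close>

lemma sum_cocycle_vector_component:
  fixes S :: "'v::finite set set"
  assumes "(v, w) \<in> arcs E"
  shows "(\<Sum>B\<in>S. c B *\<^sub>R cocycle_vector E B) $ (v, w)
    = (\<Sum>B\<in>{B\<in>S. v \<in> B}. c B) - (\<Sum>B\<in>{B\<in>S. w \<in> B}. c B)"
proof -
  have "(\<Sum>B\<in>S. c B *\<^sub>R cocycle_vector E B) $ (v, w)
    = (\<Sum>B\<in>S. (if v \<in> B then c B else 0) - (if w \<in> B then c B else 0))"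
    using assms by (auto simp: sum_component cocycle_vector_def intro!: sum.cong)
  also have "\<dots> = (\<Sum>B\<in>{B\<in>S. v \<in> B}. c B) - (\<Sum>B\<in>{B\<in>S. w \<in> B}. c B)"
    by (simp add: sum_subtractf sum.inter_filter)
  finally show ?thesis .
qed

text \<open>Logarithms translate the multiplicative parametrization into linear algebra: the
  \<open>ln (t B)\<close> are coefficients of a cocycle.\<close>

lemma sum_ln_cocycle_vector_component:
  fixes S :: "'v::finite set set"
  assumes "(v, w) \<in> arcs E" and pos: "\<forall>B\<in>S. 0 < t B"
  shows "(\<Sum>B\<in>S. ln (t B) *\<^sub>R cocycle_vector E B) $ (v, w)
    = ln (vertex_weight S t v / vertex_weight S t w)"
proof -
  have "ln (vertex_weight S t x) = (\<Sum>B\<in>{B\<in>S. x \<in> B}. ln (t B))" for x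
    unfolding vertex_weight_def using pos by (intro ln_prod) auto
  then show ?thesis
    unfolding sum_cocycle_vector_component[OF assms(1)]
    using vertex_weight_pos[OF pos, of v] vertex_weight_pos[OF pos, of w] by (simp add: ln_div)
qed

lemma cocycle_vector_trivial:
  "cocycle_vector E {} = 0" "cocycle_vector E UNIV = 0"
  by (simp_all add: cocycle_vector_def vec_eq_iff)

text \<open>A function is the combination of indicators of single vertices with its values as
  coefficients; taking coboundaries gives the combination of the vectors of the singletons.\<close>

lemma coboundary_in_cocycle_space:
  fixes f :: "'v::finite \<Rightarrow> real"
  shows "(\<chi> a. if a \<in> arcs E then f (fst a) - f (snd a) else 0) \<in> cocycle_space E"
proof -
  have "(\<chi> a. if a \<in> arcs E then f (fst a) - f (snd a) else 0)
      = (\<Sum>x\<in>UNIV. f x *\<^sub>R cocycle_vector E {x})"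
  proof (rule vec_eq_iff[THEN iffD2, rule_format])
    fix a :: "'v \<times> 'v"
    obtain v w where a: "a = (v, w)" by force
    have "(\<Sum>x\<in>UNIV. f x *\<^sub>R cocycle_vector E {x}) $ a
        = (\<Sum>x\<in>UNIV. if a \<in> arcs E then (if x = v then f x else 0) - (if x = w then f x else 0)
           else 0)"
      by (auto simp: a sum_component cocycle_vector_def intro!: sum.cong)
    also have "\<dots> = (if a \<in> arcs E then f v - f w else 0)"
      by (simp add: sum_subtractf)
    finally show "(\<chi> a. if a \<in> arcs E then f (fst a) - f (snd a) else 0) $ a
        = (\<Sum>x\<in>UNIV. f x *\<^sub>R cocycle_vector E {x}) $ a" by (simp add: a)
  qed
  also have "\<dots> \<in> cocycle_space E"
    unfolding cocycle_space_def
  proof (intro span_sum span_scale)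
    fix x :: 'v
    show "cocycle_vector E {x} \<in> span (cocycle_vector E ` {B. B \<noteq> {} \<and> B \<noteq> UNIV})"
    \<comment> \<open>In a graph with a single vertex, \<open>{x}\<close> is not a proper subset and
      so not among the generators, but its vector is zero.\<close>
    proof (cases "{x} = UNIV")
      case True
      then show ?thesis by (simp add: cocycle_vector_trivial span_zero)
    next
      case False
      then show ?thesis by (intro span_base imageI) auto
    qed
  qed
  finally show ?thesis .
qed

lemma ex_parametrization:
  fixes P :: "real^'v::finite^'v"
  assumes supp: "supporting_graph E P"
    and spanning: "span (cocycle_vector E ` S) = cocycle_space E"
    and rev: "reversible P"
  obtains s t where "parametrization E S P s t"
proof -
  obtain k where k: "\<And>v. 0 < k v" "\<And>v w. k v * P $ v $ w = k w * P $ w $ v"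
    using rev unfolding reversible_def by blast
  \<comment> \<open>The relation between \<open>kappa\<close> and the weights asks that the
    logarithm of the weight be this function, up to an additive constant.\<close>
  define f where "f v = - (1/2) * ln (k v)" for v
  have "(\<chi> a. if a \<in> arcs E then f (fst a) - f (snd a) else 0) \<in> span (cocycle_vector E ` S)"
    using coboundary_in_cocycle_space[of E f] spanning by simp
  from span_image_finite[OF finite this] obtain c where c: "(\<chi> a. if a \<in> arcs E then f (fst a) - f (snd a) else 0)
      = (\<Sum>B\<in>S. c B *\<^sub>R cocycle_vector E B)" .
  define t where "t B = exp (c B)" for B
  define g where "g = vertex_weight S t"
  have t: "\<forall>B\<in>S. 0 < t B" by (simp add: t_def)
  have g: "0 < g v" for v unfolding g_def by (rule vertex_weight_pos[OF t])
  \<comment> \<open>Only differences of \<open>f\<close> are reproduced, so \<open>k\<close> agrees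
    with the inverse square of \<open>g\<close> up to a factor that is the same at both ends of an
    arc.\<close>
  have ratio: "(g v)\<^sup>2 * k v = (g w)\<^sup>2 * k w" if "(v, w) \<in> arcs E" for v w
  proof -
    have "ln (g v / g w) = f v - f w"
      using sum_ln_cocycle_vector_component[OF that t] that
      by (simp add: t_def[abs_def] g_def flip: c)
    then have "2 * ln (g v) + ln (k v) = 2 * ln (g w) + ln (k w)"
      using g[of v] g[of w] by (simp add: f_def ln_div)
    then have "ln ((g v)\<^sup>2 * k v) = ln ((g w)\<^sup>2 * k w)"
      using g[of v] g[of w] k(1)[of v] k(1)[of w] by (simp add: ln_mult_pos ln_realpow)
    moreover have "0 < (g v)\<^sup>2 * k v" "0 < (g w)\<^sup>2 * k w"
      using g[of v] g[of w] k(1)[of v] k(1)[of w] by simp_all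
    ultimately show ?thesis by (metis ln_inj_iff)
  qed
  \<comment> \<open>The parametrization solved for \<open>s\<close>; what remains is its symmetry,
    which combines detailed balance with \<open>ratio\<close>.\<close>
  define s where "s v w = (if (v, w) \<in> arcs E then P $ v $ w * (g w / g v) else 0)" for v w
  have "s v w = s w v" for v w
  proof (cases "(v, w) \<in> arcs E")
    case True
    have "(g v)\<^sup>2 * k v * (P $ v $ w * (g w)\<^sup>2) = (k v * P $ v $ w) * ((g v)\<^sup>2 * (g w)\<^sup>2)"
      by (simp add: mult_ac)
    also have "\<dots> = (g w)\<^sup>2 * k w * (P $ w $ v * (g v)\<^sup>2)"
      unfolding k(2)[of v w] by (simp add: mult_ac)
    also have "\<dots> = (g v)\<^sup>2 * k v * (P $ w $ v * (g v)\<^sup>2)"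
      unfolding ratio[OF True] by simp
    finally have "P $ v $ w * (g w)\<^sup>2 = P $ w $ v * (g v)\<^sup>2"
      using g[of v] k(1)[of v] by simp
    then show ?thesis
      using True arcs_sym[OF True] g[of v] g[of w] by (simp add: s_def field_simps power2_eq_square)
  next
    case False
    then show ?thesis using arcs_sym[of w v E] by (auto simp: s_def)
  qed
  moreover have "0 \<le> s v w" for v w
    using supporting_graph_pos[OF supp, of v w] g[of v] g[of w] by (simp add: s_def less_imp_le)
  moreover have "P $ v $ w = s v w * (g v / g w)" if "(v, w) \<in> arcs E" for v w
    using that g[of v] g[of w] by (simp add: s_def)
  moreover have "s v w = 0" if "{v, w} \<notin> E" for v w
    using that by (simp add: s_def arcs_def)
  ultimately have "parametrization E S P s t"
    unfolding parametrization_iff using t unfolding g_def by blast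
  then show ?thesis by (rule that)
qed

section \<open>Identifiability\<close>

text \<open>The weight ratios of opposite arcs are reciprocal and cancel in the product.\<close>

lemma parametrization_symmetric_square:
  fixes S :: "'v::finite set set"
  assumes "parametrization E S P s t" "(v, w) \<in> arcs E"
  shows "(s v w)\<^sup>2 = P $ v $ w * P $ w $ v"
proof -
  have pos: "0 < vertex_weight S t x" for x
    using assms by (simp add: parametrization_iff vertex_weight_pos)
  have "P $ v $ w = s v w * (vertex_weight S t v / vertex_weight S t w)"
    "P $ w $ v = s w v * (vertex_weight S t w / vertex_weight S t v)" "s w v = s v w"
    using assms arcs_sym[OF assms(2)] unfolding parametrization_iff by auto
  then show ?thesis using pos[of v] pos[of w] by (simp add: power2_eq_square)
qed

lemma parametrization_symmetric_unique:
  fixes S :: "'v::finite set set"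
  assumes "parametrization E S P s t" "parametrization E S P s' t'" "(v, w) \<in> arcs E"
  shows "s v w = s' v w"
proof (rule power2_eq_imp_eq)
  show "(s v w)\<^sup>2 = (s' v w)\<^sup>2"
    by (simp only: parametrization_symmetric_square[OF assms(1,3)]
        parametrization_symmetric_square[OF assms(2,3)])
  show "0 \<le> s v w" "0 \<le> s' v w" using assms(1,2) by (simp_all add: parametrization_iff)
qed

lemma parametrization_weight_ratio_unique:
  fixes S :: "'v::finite set set"
  assumes supp: "supporting_graph E P"
    and par: "parametrization E S P s t" "parametrization E S P s' t'" and arc: "(v, w) \<in> arcs E"
  shows "vertex_weight S t v / vertex_weight S t w = vertex_weight S t' v / vertex_weight S t' w"
proof -
  have "P $ v $ w = s v w * (vertex_weight S t v / vertex_weight S t w)"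
    "P $ v $ w = s v w * (vertex_weight S t' v / vertex_weight S t' w)"
    using par arc parametrization_symmetric_unique[OF par arc] unfolding parametrization_iff by auto
  \<comment> \<open>The entry of \<open>P\<close> on an arc is positive, so the common factor
    \<open>s v w\<close> can be cancelled.\<close>
  moreover from this have "s v w \<noteq> 0" using supporting_graph_pos[OF supp arc] by auto
  ultimately show ?thesis by (metis mult_left_cancel)
qed

text \<open>The quotient of the two weights is constant along arcs, hence on the connected graph.
  The two functions \<open>kappa\<close> then differ by a constant factor, which normalization
  removes.\<close>

lemma normalized_kappa_unique:
  fixes S :: "'v::finite set set"
  assumes conn: "connected_graph E" and supp: "supporting_graph E P"
    and par: "parametrization E S P s t" "parametrization E S P s' t'"
  shows "normalized (kappa S t) = normalized (kappa S t')"
proof -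
  have pos: "0 < vertex_weight S t x" "0 < vertex_weight S t' x" for x
    using par by (simp_all add: parametrization_iff vertex_weight_pos)
  define q where "q v = vertex_weight S t v / vertex_weight S t' v" for v
  have "q v = q w" if "(v, w) \<in> arcs E" for v w
    using parametrization_weight_ratio_unique[OF supp par that] pos[of v] pos[of w]
    by (simp add: q_def field_simps)
  note const = connected_graph_const[where f = q, OF conn this]
  obtain c where c: "\<And>v. q v = c" using const by blast
  have "vertex_weight S t v = c * vertex_weight S t' v" for v
    using c[of v] pos[of v] by (simp add: q_def field_simps)
  moreover have "c \<noteq> 0" using c pos by (metis q_def divide_pos_pos less_irrefl)
  ultimately have "kappa S t v = inverse (c\<^sup>2) * kappa S t' v" "inverse (c\<^sup>2) \<noteq> 0" for v
    by (simp_all add: kappa_eq_vertex_weight power_mult_distrib)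
  then show ?thesis by (simp add: vec_eq_iff normalized_def flip: sum_distrib_left)
qed

text \<open>Equal weight ratios make the differences of the logarithms the coefficients of a linear
  relation among the cocycle vectors, which independence forces to be trivial.\<close>

lemma basis_parameter_unique:
  fixes S :: "'v::finite set set"
  assumes supp: "supporting_graph E P"
    and par: "parametrization E S P s t" "parametrization E S P s' t'"
    and basis: "cocycle_basis E S" and B: "B \<in> S"
  shows "t B = t' B"
proof -
  have t: "\<forall>B\<in>S. 0 < t B" "\<forall>B\<in>S. 0 < t' B" using par by (simp_all add: parametrization_iff)
  have inj: "inj_on (cocycle_vector E) S" and indep: "independent (cocycle_vector E ` S)"
    using basis by (simp_all add: cocycle_basis_def)
  define d where "d B = ln (t B) - ln (t' B)" for B
  have "(\<Sum>B\<in>S. d B *\<^sub>R cocycle_vector E B) $ a = 0" for a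
  proof (cases "a \<in> arcs E")
    case True
    obtain v w where a: "a = (v, w)" by force
    with True have arc: "(v, w) \<in> arcs E" by simp
    have "(\<Sum>B\<in>S. d B *\<^sub>R cocycle_vector E B) = (\<Sum>B\<in>S. ln (t B) *\<^sub>R cocycle_vector E B)
        - (\<Sum>B\<in>S. ln (t' B) *\<^sub>R cocycle_vector E B)"
      by (simp add: d_def scaleR_left_diff_distrib sum_subtractf)
    then have "(\<Sum>B\<in>S. d B *\<^sub>R cocycle_vector E B) $ (v, w)
        = ln (vertex_weight S t v / vertex_weight S t w)
        - ln (vertex_weight S t' v / vertex_weight S t' w)"
      by (simp only: vector_minus_component sum_ln_cocycle_vector_component[OF arc t(1)]
        sum_ln_cocycle_vector_component[OF arc t(2)])
    also have "\<dots> = 0"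
      by (simp only: parametrization_weight_ratio_unique[OF supp par arc] diff_self)
    finally show ?thesis unfolding a .
  next
    case False
    then show ?thesis by (simp add: sum_component cocycle_vector_def)
  qed
  then have "(\<Sum>B\<in>S. d B *\<^sub>R cocycle_vector E B) = 0" by (simp add: vec_eq_iff)
  \<comment> \<open>\<open>independent\<close> concerns a set of vectors, so injectivity is used to
    move the coefficients from sets \<open>B\<close> to their vectors.\<close>
  then have "(\<Sum>x\<in>cocycle_vector E ` S. d (the_inv_into S (cocycle_vector E) x) *\<^sub>R x) = 0"
    by (simp add: sum.reindex[OF inj] the_inv_into_f_f[OF inj])
  then have "d (the_inv_into S (cocycle_vector E) (cocycle_vector E B)) = 0"
    by (rule independentD[OF indep finite_imageI[OF finite] subset_refl]) (use B in simp)
  then have "ln (t B) = ln (t' B)" using B by (simp add: the_inv_into_f_f[OF inj] d_def)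
  then show ?thesis using t B by simp
qed

section \<open>Equivalence, inequality and identifiability combined\<close>

text \<open>Invariance of \<open>kappa\<close> yields unit row sums but does not force a
  non-negative diagonal; this is either assumed or supplied by the vertex inequalities. Without a
  basis, changing \<open>t\<close> along a linear relation among the cocycle vectors may scale all
  weights by a common factor, so \<open>kappa\<close> is then identified in normalized form.\<close>

theorem theorem5:
  fixes E :: "'v::finite set set"
    and S :: "'v set set"
    and P :: "real^'v^'v"
  assumes graph: "connected_graph E"
    and supp: "supporting_graph E P"
    and proper: "\<And>B. B \<in> S \<Longrightarrow> B \<noteq> {} \<and> B \<noteq> UNIV"
    and spanning: "span (cocycle_vector E ` S) = cocycle_space E"
  shows
    "((\<forall>v. 0 \<le> P $ v $ v) \<longrightarrow>
        (markov_matrix P \<and> reversible P \<longleftrightarrow>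
          (\<exists>s t. parametrization E S P s t \<and>
                 the_invariant_probability_proportional_to P (kappa S t))))
     \<and> (markov_matrix P \<and> reversible P \<longleftrightarrow>
          (\<exists>s t. parametrization E S P s t \<and>
                 the_invariant_probability_proportional_to P (kappa S t) \<and>
                 (\<forall>v. vertex_inequality E S s t v)))
     \<and> (\<forall>s t. markov_matrix P \<and> parametrization E S P s t \<longrightarrow>
          the_invariant_probability_proportional_to P (kappa S t))
     \<and> (\<forall>s t. markov_matrix P \<and> parametrization E S P s t \<longrightarrow>
          (\<forall>v. vertex_inequality E S s t v))
     \<and> (\<forall>v w. {v, w} \<in> E \<longrightarrow> identifiable E S P (\<lambda>s t. s v w))
     \<and> (\<forall>v. identifiable E S P (\<lambda>s t. normalized (kappa S t) $ v))
     \<and> (cocycle_basis E S \<longrightarrow>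
          (\<forall>B\<in>S. identifiable E S P (\<lambda>s t. t B)) \<and>
          (\<forall>v. identifiable E S P (\<lambda>s t. kappa S t v)))"
proof -
  note bal = parametrization_detailed_balance[OF supp]
  have pos: "0 < kappa S t v" if "parametrization E S P s t" for s t v
    using that by (simp add: parametrization_iff kappa_pos)
  have diagonal: "\<forall>v. 0 \<le> P $ v $ v"
    if par: "parametrization E S P s t" and row: "\<And>v. (\<Sum>w\<in>UNIV. P $ v $ w) = 1"
      and ineq: "\<forall>v. vertex_inequality E S s t v" for s t
  proof
    fix v
    have "(\<Sum>w\<in>nbrs E v. P $ v $ w) \<le> 1" using ineq vertex_inequality_iff[OF par] by simp
    then show "0 \<le> P $ v $ v" using row[of v] supporting_graph_row_sum[OF supp, of v] by linarith
  qed
  have markov_rev: "markov_matrix P \<and> reversible P"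
    if par: "parametrization E S P s t" and row: "\<And>v. (\<Sum>w\<in>UNIV. P $ v $ w) = 1"
      and diag: "\<forall>v. 0 \<le> P $ v $ v" for s t
  proof
    have "0 \<le> P $ v $ w" for v w
      using diag supporting_graph_off_diagonal_nonneg[OF supp, of v w] by (cases "v = w") simp_all
    then show "markov_matrix P" by (simp add: markov_matrix_def row)
    show "reversible P" unfolding reversible_def
      by (intro exI[of _ "kappa S t"] conjI allI pos[OF par] bal[OF par])
  qed
  have row: "(\<Sum>w\<in>UNIV. P $ v $ w) = 1"
    if "parametrization E S P s t" "the_invariant_probability_proportional_to P (kappa S t)" for s t v
    using row_sum_if_invariant_probability_proportional[OF pos[OF that(1)] bal[OF that(1)] that(2)] .
  have invariant: "the_invariant_probability_proportional_to P (kappa S t)"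
    if "markov_matrix P" "parametrization E S P s t" for s t
    using invariant_probability_detailed_balance[OF graph supp that(1) pos[OF that(2)] bal[OF that(2)]] .
  have ineq: "vertex_inequality E S s t v"
    if "markov_matrix P" "parametrization E S P s t" for s t v
  proof -
    have "0 \<le> P $ v $ v" "(\<Sum>w\<in>UNIV. P $ v $ w) = 1"
      using that by (simp_all add: markov_matrix_def)
    then show ?thesis
      unfolding vertex_inequality_iff[OF that(2)] supporting_graph_row_sum[OF supp] by linarith
  qed
  have ident_s: "identifiable E S P (\<lambda>s t. s v w)" if "{v, w} \<in> E" for v w
  proof -
    have "v \<noteq> w" using that graph by (auto simp: connected_graph_def)
    with that have "(v, w) \<in> arcs E" by (simp add: arcs_def)
    then show ?thesis
      unfolding identifiable_def
      by (intro allI impI) (rule parametrization_symmetric_unique)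
  qed
  have ident_kappa: "identifiable E S P (\<lambda>s t. normalized (kappa S t) $ v)" for v
    unfolding identifiable_def
    by (intro allI impI arg_cong[where f = "\<lambda>p. p $ v"]) (rule normalized_kappa_unique[OF graph supp])
  have ident_t: "identifiable E S P (\<lambda>s t. t B)" if "cocycle_basis E S" "B \<in> S" for B
    unfolding identifiable_def
    by (intro allI impI) (rule basis_parameter_unique[OF supp _ _ that])
  have ident_kappa_basis: "identifiable E S P (\<lambda>s t. kappa S t v)" if "cocycle_basis E S" for v
    unfolding identifiable_def kappa_def
  proof (intro allI impI)
    fix s t s' t'
    assume par: "parametrization E S P s t" "parametrization E S P s' t'"
    show "(\<Prod>B\<in>{B\<in>S. v \<in> B}. inverse ((t B)\<^sup>2)) = (\<Prod>B\<in>{B\<in>S. v \<in> B}. inverse ((t' B)\<^sup>2))"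
      by (rule prod.cong) (simp_all add: basis_parameter_unique[OF supp par that])
  qed
  \<comment> \<open>Reversibility has to provide only the parametrization: for a Markov matrix,
    every parametrization has the other two properties.\<close>
  have ex: "\<exists>s t. parametrization E S P s t \<and>
      the_invariant_probability_proportional_to P (kappa S t) \<and> (\<forall>v. vertex_inequality E S s t v)"
    if markov: "markov_matrix P" and rev: "reversible P"
  proof -
    obtain s t where par: "parametrization E S P s t"
      using ex_parametrization[OF supp spanning rev] .
    show ?thesis
      by (intro exI[of _ s] exI[of _ t] conjI allI par invariant[OF markov par] ineq[OF markov par])
  qed
  have iff_diagonal: "markov_matrix P \<and> reversible P \<longleftrightarrow> (\<exists>s t. parametrization E S P s t \<and>
      the_invariant_probability_proportional_to P (kappa S t))" if "\<forall>v. 0 \<le> P $ v $ v"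
    using ex markov_rev row that by metis
  have iff_inequality: "markov_matrix P \<and> reversible P \<longleftrightarrow> (\<exists>s t. parametrization E S P s t \<and>
      the_invariant_probability_proportional_to P (kappa S t) \<and> (\<forall>v. vertex_inequality E S s t v))"
    using ex markov_rev row diagonal by metis
  show ?thesis
    by (intro conjI allI impI ballI iff_diagonal iff_inequality invariant ineq
        ident_s ident_kappa ident_t ident_kappa_basis) blast+
qed

end
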